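(* For every integer $n\ge 0$, $$\sum_{T\in\mathcal{PT}(n)}\operatorname{sign}(T) =\frac{(1+i)^n + (1-i)^n}{2},$$ where $i$ is the imaginary unit and $\operatorname{sign}(T)=(-1)^{\operatorname{urc}(T)}$.
   Context: Ferrers diagrams: a Ferrers diagram is a left-justified arrangement of square cells, possibly with empty rows; its length is the number of rows plus the number of columns. The steps of the south-east border are labeled $1,\dots,n$ from north-east to south-west ($n$ the length); a row gets the label of its south step and a column the label of its west step. Equivalently, a diagram of length $n$ is a splitting of $\{1,\dots,n\}$ into row labels and column labels; rows are listed top to bottom in increasing order of label, columns left to right in decreasing order of label, and there is a cell in Row $r$ and Column $c$ exactly when $r<c$. Permutation tableaux: a permutation tableau is a Ferrers diagram with a filling of its cells by $0$'s and $1$'s such that (1) each column has at least one $1$; (2) there is no $0$ having both a $1$ above it in the same column and a $1$ to the left of it in the same row. $\mathcal{PT}(n)$ is the set of permutation tableaux of length $n$ ($\mathcal{PT}(0)$ consists of the single empty tableau). A column is unrestricted if it contains no $0$ that has a $1$ to the left of it in the same row; $\operatorname{urc}(T)$ is the number of unrestricted columns of $T$. *)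

theory Defs
  imports Complex_Main
begin

text \<open>
  A filled Ferrers diagram is given by its row labels, its column labels and the set of those
  cells, named (row label, column label), that contain a 1; all other cells contain a 0.
\<close>

record tableau =
  row_labels :: "nat set"
  col_labels :: "nat set"
  ones :: "(nat \<times> nat) set"

definition cells :: "tableau \<Rightarrow> (nat \<times> nat) set" where
  "cells T = {(r, c). r \<in> row_labels T \<and> c \<in> col_labels T \<and> r < c}"

definition zeros :: "tableau \<Rightarrow> (nat \<times> nat) set" where
  "zeros T = cells T - ones T"

definition filled_diagram :: "nat \<Rightarrow> tableau \<Rightarrow> bool" where
  "filled_diagram n T \<longleftrightarrow>
     row_labels T \<union> col_labels T = {1..n} \<and>
     row_labels T \<inter> col_labels T = {} \<and>
     ones T \<subseteq> cells T"

text \<open>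
  Rows are ordered top to bottom by increasing label, so ``above'' means smaller row label;
  columns are ordered left to right by decreasing label, so ``to the left'' means larger
  column label.
\<close>

definition one_above :: "tableau \<Rightarrow> nat \<Rightarrow> nat \<Rightarrow> bool" where
  "one_above T r c \<longleftrightarrow> (\<exists>r'. r' < r \<and> (r', c) \<in> ones T)"

definition one_left :: "tableau \<Rightarrow> nat \<Rightarrow> nat \<Rightarrow> bool" where
  "one_left T r c \<longleftrightarrow> (\<exists>c'. c' > c \<and> (r, c') \<in> ones T)"

definition perm_tableaux :: "nat \<Rightarrow> tableau set" where
  "perm_tableaux n = {T. filled_diagram n T \<and>
     (\<forall>c \<in> col_labels T. \<exists>r. (r, c) \<in> ones T) \<and>
     (\<forall>(r, c) \<in> zeros T. \<not> (one_above T r c \<and> one_left T r c))}"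

definition unrestricted_col :: "tableau \<Rightarrow> nat \<Rightarrow> bool" where
  "unrestricted_col T c \<longleftrightarrow> \<not> (\<exists>r. (r, c) \<in> zeros T \<and> one_left T r c)"

definition urc :: "tableau \<Rightarrow> nat" where
  "urc T = card {c \<in> col_labels T. unrestricted_col T c}"

definition tableau_sign :: "tableau \<Rightarrow> int" where
  "tableau_sign T = (-1) ^ urc T"

lemma finite_perm_tableaux: "finite (perm_tableaux n)"
proof (rule finite_subset)
  let ?S = "Pow {1..n} \<times> Pow {1..n} \<times> Pow ({1..n} \<times> {1..n})"
  let ?f = "\<lambda>(R, C, F). \<lparr>row_labels = R, col_labels = C, ones = F\<rparr>"
  show "perm_tableaux n \<subseteq> ?f ` ?S"
  proof
    fix T assume "T \<in> perm_tableaux n"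
    then have T: "filled_diagram n T"
      by (simp add: perm_tableaux_def)
    then have "row_labels T \<subseteq> {1..n}" "col_labels T \<subseteq> {1..n}"
      unfolding filled_diagram_def by blast+
    moreover from this have "ones T \<subseteq> {1..n} \<times> {1..n}"
      using T unfolding filled_diagram_def cells_def by blast
    ultimately have "(row_labels T, col_labels T, ones T) \<in> ?S" by blast
    moreover have "T = ?f (row_labels T, col_labels T, ones T)" by simp
    ultimately show "T \<in> ?f ` ?S" by (rule rev_image_eqI)
  qed
  show "finite (?f ` ?S)" by (intro finite_imageI finite_cartesian_product) auto
qed

end

theory Submission
  imports Defs
begin

text \<open>
  Build a tableau from its south-west end, prepending the labels n, n - 1, ..., 1. A prepended
  column has no cells yet. A prepended row may carry 1s only in unrestricted columns, and it makes
  each column without a new 1 that lies to the right of a new 1 restricted; a column without 1s may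
  never become restricted, because it could not receive a 1 later. So all that matters is the state
  \<open>(A, B)\<close>: the set \<open>A\<close> of unrestricted columns containing a 1 and the set \<open>B\<close> of columns
  without a 1. Writing \<open>e\<close> for the final weight and \<open>V\<close> for summation over all possible new rows,
  one has \<open>V (V e) = 3 V e - 2 e\<close>, and prepending a column turns \<open>e\<close> into 0 and \<open>V e\<close> into \<open>- V e\<close>.
  The span of \<open>e\<close> and \<open>V e\<close> is thus invariant under prepending a label, and on the basis
  \<open>e, V e - e\<close> this step acts as multiplication by \<open>1 + \<i>\<close> acts on \<open>1, \<i>\<close>.
\<close>

section \<open>States and the sums over one new row\<close>

definition disj_fin :: "nat set \<Rightarrow> nat set \<Rightarrow> bool" where
  "disj_fin A B \<longleftrightarrow> finite A \<and> finite B \<and> A \<inter> B = {}"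

text \<open>\<open>S\<close> is the set of columns in which the new row has a 1. Labels decrease
  from left to right, so \<open>b < s\<close> places column \<open>b\<close> to the right of a new
  1; a 0 there would restrict \<open>b\<close> for good.\<close>

definition top_rows :: "nat set \<Rightarrow> nat set \<Rightarrow> nat set set" where
  "top_rows A B = {S. S \<subseteq> A \<union> B \<and> (\<forall>b\<in>B. \<forall>s\<in>S. b < s \<longrightarrow> b \<in> S)}"

text \<open>This is the operator V of the overview. A column of \<open>A\<close> stays unrestricted
  if it gets a 1 or lies to the left of all new 1s; columns of \<open>B\<close> that get a 1 move to
  the first argument.\<close>

definition row_sum :: "(nat set \<Rightarrow> nat set \<Rightarrow> complex) \<Rightarrow> nat set \<Rightarrow> nat set \<Rightarrow> complex" where
  "row_sum h A B = (\<Sum>S\<in>top_rows A B. h (S \<union> {a\<in>A. \<forall>s\<in>S. s < a}) (B - S))"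

text \<open>
  What a new row contributes from the columns to the right of its leftmost 1: columns in \<open>A\<close> without
  a new 1 become restricted, and every column in \<open>B\<close> must receive a 1.
\<close>

definition fill_sum :: "(nat set \<Rightarrow> nat set \<Rightarrow> complex) \<Rightarrow> nat set \<Rightarrow> nat set \<Rightarrow> complex" where
  "fill_sum h A B = (\<Sum>S\<in>Pow A. h (S \<union> B) {})"

definition sgn_state :: "nat set \<Rightarrow> nat set \<Rightarrow> complex" where
  "sgn_state A B = (if B = {} then (-1) ^ card A else 0)"

text \<open>The largest label belongs to the leftmost column. Removing it suits
  \<open>row_sum\<close>: if that column gets a 1, then all of \<open>B\<close> is forced, and
  otherwise the column keeps its status.\<close>

lemma disj_fin_induct [consumes 1, case_names empty left right]:
  assumes "disj_fin A B"
    and "P {} {}"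
    and "\<And>c A B. disj_fin A B \<Longrightarrow> \<forall>x\<in>A \<union> B. x < c \<Longrightarrow> P A B \<Longrightarrow> P (insert c A) B"
    and "\<And>c A B. disj_fin A B \<Longrightarrow> \<forall>x\<in>A \<union> B. x < c \<Longrightarrow> P A B \<Longrightarrow> P A (insert c B)"
  shows "P A B"
proof -
  have "finite U \<Longrightarrow> \<forall>A B. A \<union> B = U \<longrightarrow> disj_fin A B \<longrightarrow> P A B" for U :: "nat set"
  proof (induction U rule: finite_linorder_max_induct)
    case empty
    then show ?case using assms(2) by simp
  next
    case (insert c U)
    show ?case
    proof (intro allI impI)
      fix A B assume AB: "A \<union> B = insert c U" "disj_fin A B"
      have cU: "c \<notin> U" using insert.hyps by auto
      show "P A B"
      proof (cases "c \<in> A")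
        case True
        have d: "disj_fin (A - {c}) B" and u: "(A - {c}) \<union> B = U"
          using AB cU True unfolding disj_fin_def by auto
        have "P (insert c (A - {c})) B"
          by (rule assms(3)[OF d]) (use insert u d in simp_all)
        then show ?thesis using True by (simp add: insert_absorb)
      next
        case False
        then have cB: "c \<in> B" using AB by auto
        have d: "disj_fin A (B - {c})" and u: "A \<union> (B - {c}) = U"
          using AB cU False unfolding disj_fin_def by auto
        have "P A (insert c (B - {c}))"
          by (rule assms(4)[OF d]) (use insert u d in simp_all)
        then show ?thesis using cB by (simp add: insert_absorb)
      qed
    qed
  qed
  from this[of "A \<union> B"] show ?thesis using assms(1) by (simp add: disj_fin_def)
qed

lemma finite_top_rows: "disj_fin A B \<Longrightarrow> finite (top_rows A B)"
  unfolding top_rows_def disj_fin_def by (rule finite_subset[of _ "Pow (A \<union> B)"]) auto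

lemma row_sum_cong:
  assumes "disj_fin A B"
    and "\<And>A' B'. disj_fin A' B' \<Longrightarrow> A' \<union> B' \<subseteq> A \<union> B \<Longrightarrow> h A' B' = g A' B'"
  shows "row_sum h A B = row_sum g A B"
  unfolding row_sum_def
proof (rule sum.cong[OF refl])
  fix S assume "S \<in> top_rows A B"
  then have S: "S \<subseteq> A \<union> B" by (simp add: top_rows_def)
  show "h (S \<union> {a\<in>A. \<forall>s\<in>S. s < a}) (B - S) = g (S \<union> {a\<in>A. \<forall>s\<in>S. s < a}) (B - S)"
    using S assms(1) finite_subset[OF S]
    by (intro assms(2)) (auto simp: disj_fin_def)
qed

lemma fill_sum_cong:
  assumes "disj_fin A B"
    and "\<And>A' B'. disj_fin A' B' \<Longrightarrow> A' \<union> B' \<subseteq> A \<union> B \<Longrightarrow> h A' B' = g A' B'"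
  shows "fill_sum h A B = fill_sum g A B"
  unfolding fill_sum_def
  using assms(1) by (intro sum.cong refl assms(2)) (auto simp: disj_fin_def intro: finite_subset)

lemma fill_sum_empty [simp]: "fill_sum h {} {} = h {} {}"
  by (simp add: fill_sum_def)

lemma row_sum_empty [simp]: "row_sum h {} {} = h {} {}"
proof -
  have "top_rows {} {} = {{}}" by (auto simp: top_rows_def)
  then show ?thesis by (simp add: row_sum_def)
qed

lemma fill_sum_right: "fill_sum h A (insert c B) = fill_sum (\<lambda>X Y. h (insert c X) Y) A B"
  by (simp add: fill_sum_def)

lemma sum_Pow_insert:
  assumes "finite A" "c \<notin> A"
  shows "(\<Sum>S\<in>Pow (insert c A). f S) = (\<Sum>S\<in>Pow A. f (insert c S)) + (\<Sum>S\<in>Pow A. f S :: complex)"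
proof -
  have "inj_on (insert c) (Pow A)" using assms(2) by (auto simp: inj_on_def)
  moreover have "Pow A \<inter> insert c ` Pow A = {}" using assms(2) by auto
  ultimately show ?thesis
    using assms(1) by (simp add: Pow_insert sum.union_disjoint sum.reindex)
qed

lemma fill_sum_left:
  assumes "disj_fin A B" "c \<notin> A"
  shows "fill_sum h (insert c A) B = fill_sum (\<lambda>X Y. h (insert c X) Y) A B + fill_sum h A B"
  using assms unfolding fill_sum_def disj_fin_def by (simp add: sum_Pow_insert)

text \<open>The two summands are the rows with and without a 1 in the leftmost column
  \<open>c\<close>. With it, every column of \<open>B\<close> must get a 1 and no column lies to the
  left of all new 1s, so only a subset of \<open>A\<close> is free to choose. Without it, the row is
  admissible for \<open>A\<close> and \<open>B\<close>. The disjunction treats both possible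
  statuses of \<open>c\<close> at once.\<close>

lemma row_sum_split:
  assumes "disj_fin A B" "\<forall>x\<in>A \<union> B. x < c"
    and "C = insert c A \<and> D = B \<or> C = A \<and> D = insert c B"
  shows "row_sum h C D = fill_sum (\<lambda>X Y. h (insert c X) Y) A B +
    (\<Sum>S\<in>top_rows A B. h (S \<union> {a\<in>C. \<forall>s\<in>S. s < a}) (D - S))"
proof -
  have c: "c \<notin> A" "c \<notin> B" and cd: "A \<inter> B = {}" using assms by (auto simp: disj_fin_def)
  let ?f = "\<lambda>S. insert c (S \<union> B)"
  let ?g = "\<lambda>S. h (S \<union> {a\<in>C. \<forall>s\<in>S. s < a}) (D - S)"
  have "top_rows C D = ?f ` Pow A \<union> top_rows A B"
  proof (intro equalityI subsetI)
    fix S assume S: "S \<in> top_rows C D"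
    show "S \<in> ?f ` Pow A \<union> top_rows A B"
    proof (cases "c \<in> S")
      case True
      have "B \<subseteq> S" using S True assms by (auto simp: top_rows_def)
      moreover have "S \<subseteq> insert c (A \<union> B)" using S assms(3) by (auto simp: top_rows_def)
      ultimately have "S = ?f (S \<inter> A)" using True by auto
      then show ?thesis by blast
    next
      case False
      then show ?thesis using S assms(3) by (auto simp: top_rows_def)
    qed
  next
    fix S assume S: "S \<in> ?f ` Pow A \<union> top_rows A B"
    have CD: "C \<union> D = insert c (A \<union> B)" "D \<subseteq> insert c B" using assms(3) by auto
    from S show "S \<in> top_rows C D"
    proof
      assume "S \<in> ?f ` Pow A"
      then have "S \<subseteq> C \<union> D" "D \<subseteq> S" using CD by auto
      then show ?thesis by (auto simp: top_rows_def)
    next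
      assume S: "S \<in> top_rows A B"
      then have lt: "s < c" if "s \<in> S" for s using that assms(2) by (auto simp: top_rows_def)
      have "b \<in> B" if "b \<in> D" "s \<in> S" "b < s" for b s
        using lt[OF that(2)] that CD(2) by auto
      then show ?thesis using S CD(1) by (auto simp: top_rows_def)
    qed
  qed
  moreover have "?f ` Pow A \<inter> top_rows A B = {}" using c by (auto simp: top_rows_def)
  moreover have "inj_on ?f (Pow A)"
    using c cd by (intro inj_on_inverseI[of _ "\<lambda>S. S \<inter> A"]) auto
  moreover have "?g (?f S) = h (insert c (S \<union> B)) {}" if "S \<in> Pow A" for S
  proof -
    have "a \<le> c" if "a \<in> C" for a using that assms(2,3) by (auto intro: less_imp_le)
    then have "{a\<in>C. \<forall>s\<in>?f S. s < a} = {}" by (auto simp: not_less)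
    moreover have "D - ?f S = {}" using assms(3) by auto
    ultimately show ?thesis by (simp only: Un_empty_right)
  qed
  ultimately show ?thesis
    using assms(1) finite_top_rows[OF assms(1)] unfolding row_sum_def fill_sum_def
    by (simp add: sum.union_disjoint disj_fin_def sum.reindex)
qed

lemma row_sum_left:
  assumes "disj_fin A B" "\<forall>x\<in>A \<union> B. x < c"
  shows "row_sum h (insert c A) B =
    fill_sum (\<lambda>X Y. h (insert c X) Y) A B + row_sum (\<lambda>X Y. h (insert c X) Y) A B"
proof -
  have "S \<union> {a\<in>insert c A. \<forall>s\<in>S. s < a} = insert c (S \<union> {a\<in>A. \<forall>s\<in>S. s < a})"
    if "S \<in> top_rows A B" for S
    using that assms(2) by (auto simp: top_rows_def)
  then show ?thesis
    using row_sum_split[OF assms, of "insert c A" B h] by (simp add: row_sum_def)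
qed

lemma row_sum_right:
  assumes "disj_fin A B" "\<forall>x\<in>A \<union> B. x < c"
  shows "row_sum h A (insert c B) =
    fill_sum (\<lambda>X Y. h (insert c X) Y) A B + row_sum (\<lambda>X Y. h X (insert c Y)) A B"
proof -
  have "insert c B - S = insert c (B - S)" if "S \<in> top_rows A B" for S
    using that assms(2) by (auto simp: top_rows_def)
  then show ?thesis
    using row_sum_split[OF assms, of A "insert c B" h] by (simp add: row_sum_def)
qed

lemma row_sum_linear:
  "row_sum (\<lambda>X Y. p * f X Y + q * g X Y) A B = p * row_sum f A B + q * row_sum g A B"
  by (simp add: row_sum_def sum.distrib sum_distrib_left)

lemma row_sum_0 [simp]: "row_sum (\<lambda>X Y. 0) A B = 0"
  and fill_sum_0 [simp]: "fill_sum (\<lambda>X Y. 0) A B = 0"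
  by (simp_all add: row_sum_def fill_sum_def)

lemma row_sum_minus: "row_sum (\<lambda>X Y. - f X Y) A B = - row_sum f A B"
  and fill_sum_minus: "fill_sum (\<lambda>X Y. - f X Y) A B = - fill_sum f A B"
  by (simp_all add: row_sum_def fill_sum_def sum_negf)

lemma row_sum_diff: "row_sum (\<lambda>X Y. f X Y - g X Y) A B = row_sum f A B - row_sum g A B"
  and fill_sum_diff: "fill_sum (\<lambda>X Y. f X Y - g X Y) A B = fill_sum f A B - fill_sum g A B"
  by (simp_all add: row_sum_def fill_sum_def sum_subtractf)

section \<open>Recurrences for the sign weight when a leftmost column is added\<close>

abbreviation "fill_sgn \<equiv> fill_sum sgn_state"
abbreviation "row_sgn \<equiv> row_sum sgn_state"

lemma sgn_state_left: "disj_fin A B \<Longrightarrow> c \<notin> A \<Longrightarrow> sgn_state (insert c A) B = - sgn_state A B"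
  by (simp add: sgn_state_def disj_fin_def)

lemma sgn_state_right [simp]: "sgn_state A (insert c B) = 0"
  by (simp add: sgn_state_def)

context
  fixes A B :: "nat set" and c :: nat
  assumes AB: "disj_fin A B" and c: "\<forall>x\<in>A \<union> B. x < c"
begin

lemma sums_sgn_state_insert:
  "fill_sum (\<lambda>X. sgn_state (insert c X)) A B = - fill_sgn A B"
  "row_sum (\<lambda>X. sgn_state (insert c X)) A B = - row_sgn A B"
  unfolding fill_sum_minus[symmetric] row_sum_minus[symmetric]
  by (rule fill_sum_cong[OF AB] row_sum_cong[OF AB], use c in \<open>auto intro!: sgn_state_left\<close>)+

text \<open>Rows with and without a 1 in column \<open>c\<close> cancel in pairs, since
  \<open>c\<close> stays unrestricted exactly in the former and this flips the sign.\<close>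

lemma fill_sgn_left: "fill_sgn (insert c A) B = 0"
  using fill_sum_left[OF AB, of c sgn_state] c sums_sgn_state_insert by auto

lemma fill_sgn_right: "fill_sgn A (insert c B) = - fill_sgn A B"
  by (simp add: fill_sum_right sums_sgn_state_insert)

lemma row_sgn_left: "row_sgn (insert c A) B = - fill_sgn A B - row_sgn A B"
  by (simp add: row_sum_left[OF AB c] sums_sgn_state_insert)

lemma row_sgn_right: "row_sgn A (insert c B) = - fill_sgn A B"
  by (simp add: row_sum_right[OF AB c] sums_sgn_state_insert)

end

section \<open>Double sums and the quadratic relation for V\<close>

context
  fixes A B :: "nat set" and c :: nat
  assumes AB: "disj_fin A B" and c: "\<forall>x\<in>A \<union> B. x < c"
begin

text \<open>Inside an outer sum the recurrences are needed at all states over subsets of the given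
  columns, which is why they were first generalised by closing the previous context. Column
  \<open>c\<close> is still leftmost for those states.\<close>

lemma below_subset: "A' \<union> B' \<subseteq> A \<union> B \<Longrightarrow> \<forall>x\<in>A' \<union> B'. x < c"
  using c by blast

lemma sums_fill_sgn_insert:
  "fill_sum (\<lambda>X. fill_sgn (insert c X)) A B = 0"
  "row_sum (\<lambda>X. fill_sgn (insert c X)) A B = 0"
  "row_sum (\<lambda>X Y. fill_sgn X (insert c Y)) A B = - row_sum fill_sgn A B"
proof -
  have "fill_sum (\<lambda>X. fill_sgn (insert c X)) A B = fill_sum (\<lambda>_ _. 0) A B"
    by (rule fill_sum_cong[OF AB], rule fill_sgn_left[OF _ below_subset], assumption+)
  then show "fill_sum (\<lambda>X. fill_sgn (insert c X)) A B = 0" by simp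
  have "row_sum (\<lambda>X. fill_sgn (insert c X)) A B = row_sum (\<lambda>_ _. 0) A B"
    by (rule row_sum_cong[OF AB], rule fill_sgn_left[OF _ below_subset], assumption+)
  then show "row_sum (\<lambda>X. fill_sgn (insert c X)) A B = 0" by simp
  show "row_sum (\<lambda>X Y. fill_sgn X (insert c Y)) A B = - row_sum fill_sgn A B"
    unfolding row_sum_minus[symmetric]
    by (rule row_sum_cong[OF AB], rule fill_sgn_right[OF _ below_subset], assumption+)
qed

lemma sums_row_sgn_insert:
  "fill_sum (\<lambda>X. row_sgn (insert c X)) A B = - fill_sum fill_sgn A B - fill_sum row_sgn A B"
  "row_sum (\<lambda>X. row_sgn (insert c X)) A B = - row_sum fill_sgn A B - row_sum row_sgn A B"
  "row_sum (\<lambda>X Y. row_sgn X (insert c Y)) A B = - row_sum fill_sgn A B"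
proof -
  let ?g = "\<lambda>X Y. - fill_sgn X Y - row_sgn X Y"
  have "fill_sum (\<lambda>X. row_sgn (insert c X)) A B = fill_sum ?g A B"
    by (rule fill_sum_cong[OF AB], rule row_sgn_left[OF _ below_subset], assumption+)
  then show "fill_sum (\<lambda>X. row_sgn (insert c X)) A B =
      - fill_sum fill_sgn A B - fill_sum row_sgn A B"
    unfolding fill_sum_diff fill_sum_minus .
  have "row_sum (\<lambda>X. row_sgn (insert c X)) A B = row_sum ?g A B"
    by (rule row_sum_cong[OF AB], rule row_sgn_left[OF _ below_subset], assumption+)
  then show "row_sum (\<lambda>X. row_sgn (insert c X)) A B =
      - row_sum fill_sgn A B - row_sum row_sgn A B"
    unfolding row_sum_diff row_sum_minus .
  show "row_sum (\<lambda>X Y. row_sgn X (insert c Y)) A B = - row_sum fill_sgn A B"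
    unfolding row_sum_minus[symmetric]
    by (rule row_sum_cong[OF AB], rule row_sgn_right[OF _ below_subset], assumption+)
qed

end

text \<open>Write F for \<open>fill_sum\<close>, V for \<open>row_sum\<close> and e for
  \<open>sgn_state\<close>. The left side is the term that enters V (V e), negated, when a leftmost
  column is added. Adding the column to \<open>A\<close> makes both sides 0, adding it to
  \<open>B\<close> negates both, and at the empty state each of the three terms is 1.\<close>

lemma fill_row_sgn_relation:
  assumes "disj_fin A B"
  shows "fill_sum fill_sgn A B + fill_sum row_sgn A B + row_sum fill_sgn A B = 3 * fill_sgn A B"
  using assms
proof (induction rule: disj_fin_induct)
  case empty
  then show ?case by simp
next
  case (left c A B)
  note hyps = left.hyps
  have c: "c \<notin> A" using hyps(2) by auto
  have "fill_sum fill_sgn (insert c A) B = fill_sum fill_sgn A B"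
    unfolding fill_sum_left[OF hyps(1) c] sums_fill_sgn_insert[OF hyps] by simp
  moreover have "fill_sum row_sgn (insert c A) B = - fill_sum fill_sgn A B"
    unfolding fill_sum_left[OF hyps(1) c] sums_row_sgn_insert[OF hyps] by simp
  moreover have "row_sum fill_sgn (insert c A) B = 0"
    unfolding row_sum_left[OF hyps] sums_fill_sgn_insert[OF hyps] by simp
  ultimately show ?case
    unfolding fill_sgn_left[OF hyps] by simp
next
  case (right c A B)
  note hyps = right.hyps
  have "fill_sum fill_sgn A (insert c B) = 0"
    unfolding fill_sum_right sums_fill_sgn_insert[OF hyps] by (rule refl)
  moreover have "fill_sum row_sgn A (insert c B) = - fill_sum fill_sgn A B - fill_sum row_sgn A B"
    unfolding fill_sum_right sums_row_sgn_insert[OF hyps] by (rule refl)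
  moreover have "row_sum fill_sgn A (insert c B) = - row_sum fill_sgn A B"
    by (simp only: row_sum_right[OF hyps] sums_fill_sgn_insert[OF hyps] add_0_left)
  ultimately have "fill_sum fill_sgn A (insert c B) + fill_sum row_sgn A (insert c B) +
      row_sum fill_sgn A (insert c B) =
      - (fill_sum fill_sgn A B + fill_sum row_sgn A B + row_sum fill_sgn A B)"
    by simp
  then show ?case
    unfolding right.IH fill_sgn_right[OF hyps] by simp
qed

text \<open>With F, V, e as before, adding a leftmost column to \<open>A\<close> turns V (V e) into
  - 3 F e - V (V e), and adding it to \<open>B\<close> gives - 3 F e, both by the preceding
  relation. The right side follows the same recurrences, because V e becomes - F e - V e or - F e,
  and e becomes - e or 0.\<close>

lemma row_sum_row_sgn:
  assumes "disj_fin A B"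
  shows "row_sum row_sgn A B = 3 * row_sgn A B - 2 * sgn_state A B"
  using assms
proof (induction rule: disj_fin_induct)
  case empty
  then show ?case by simp
next
  case (left c A B)
  note hyps = left.hyps
  have c: "c \<notin> A" using hyps(2) by auto
  show ?case
    unfolding row_sum_left[OF hyps, of row_sgn] sums_row_sgn_insert[OF hyps] row_sgn_left[OF hyps]
      sgn_state_left[OF hyps(1) c] left.IH
    using fill_row_sgn_relation[OF hyps(1)] by (simp add: algebra_simps)
next
  case (right c A B)
  note hyps = right.hyps
  show ?case
    unfolding row_sum_right[OF hyps, of row_sgn] sums_row_sgn_insert[OF hyps] row_sgn_right[OF hyps]
    using fill_row_sgn_relation[OF hyps(1)] by (simp add: algebra_simps)
qed

text \<open>The new column \<open>c\<close> is rightmost and has no 1, so every nonempty row must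
  put a 1 into it. The empty row leaves \<open>c\<close> without a 1 and has weight 0; each other
  row is an admissible row for \<open>A\<close> and \<open>B\<close> with \<open>c\<close> added,
  which creates one more unrestricted column and flips the sign.\<close>

lemma row_sgn_insert_below:
  assumes "disj_fin A B" "\<forall>x\<in>A \<union> B. c < x"
  shows "row_sgn A (insert c B) = - row_sgn A B"
proof -
  have c: "c \<notin> A" "c \<notin> B" using assms by auto
  have *: "top_rows A (insert c B) = insert {} (insert c ` top_rows A B)"
  proof (intro equalityI subsetI)
    fix S assume S: "S \<in> top_rows A (insert c B)"
    show "S \<in> insert {} (insert c ` top_rows A B)"
    proof (cases "S = {}")
      case False
      then have "c \<in> S" using S assms(2) by (auto simp: top_rows_def)
      then have "S = insert c (S - {c})" by auto
      moreover have "S - {c} \<in> top_rows A B" using S c by (auto simp: top_rows_def)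
      ultimately show ?thesis by blast
    qed simp
  next
    fix S assume "S \<in> insert {} (insert c ` top_rows A B)"
    then show "S \<in> top_rows A (insert c B)"
    proof
      assume "S \<in> insert c ` top_rows A B"
      then obtain S' where S': "S' \<in> top_rows A B" "S = insert c S'" by blast
      have "\<not> b < c" if "b \<in> B" for b
        using that assms(2) by (simp add: not_less less_imp_le)
      then show ?thesis using S' by (auto simp: top_rows_def)
    qed (simp add: top_rows_def)
  qed
  have inj: "inj_on (insert c) (top_rows A B)"
    using c by (auto simp: inj_on_def top_rows_def)
  have eq: "sgn_state (insert c S \<union> {a\<in>A. \<forall>s\<in>insert c S. s < a}) (insert c B - insert c S) =
      - sgn_state (S \<union> {a\<in>A. \<forall>s\<in>S. s < a}) (B - S)" (is "?l = ?r")
    if "S \<in> top_rows A B" for S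
  proof -
    have S: "S \<subseteq> A \<union> B" using that by (simp add: top_rows_def)
    have "?l = sgn_state (insert c (S \<union> {a\<in>A. \<forall>s\<in>S. s < a})) (B - S)"
      using assms(2) c by (intro arg_cong2[of _ _ _ _ sgn_state]) auto
    also have "\<dots> = ?r"
      using S assms(1) c finite_subset[OF S] by (intro sgn_state_left) (auto simp: disj_fin_def)
    finally show ?thesis .
  qed
  show ?thesis
    using finite_top_rows[OF assms(1)] eq unfolding row_sum_def *
    by (subst sum.insert) (auto simp: sum.reindex[OF inj] sum_negf[symmetric])
qed

section \<open>Partial tableaux and their states\<close>

text \<open>
  Tableaux on the labels \<open>{m<..n}\<close> that can still be completed by prepending rows.
\<close>

definition partial_tableaux :: "nat \<Rightarrow> nat \<Rightarrow> tableau set" where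
  "partial_tableaux m n = {T.
     row_labels T \<union> col_labels T = {m<..n} \<and> row_labels T \<inter> col_labels T = {} \<and>
     ones T \<subseteq> cells T \<and>
     (\<forall>c\<in>col_labels T. unrestricted_col T c \<or> (\<exists>r. (r, c) \<in> ones T)) \<and>
     (\<forall>(r, c)\<in>zeros T. \<not> (one_above T r c \<and> one_left T r c))}"

text \<open>Together with \<open>zero_cols\<close> this gives the state (A, B). In a partial tableau
  the columns of \<open>zero_cols\<close> are unrestricted as well, so the two sets partition the
  unrestricted columns.\<close>

definition live_cols :: "tableau \<Rightarrow> nat set" where
  "live_cols T = {c \<in> col_labels T. unrestricted_col T c \<and> (\<exists>r. (r, c) \<in> ones T)}"

definition zero_cols :: "tableau \<Rightarrow> nat set" where
  "zero_cols T = {c \<in> col_labels T. \<forall>r. (r, c) \<notin> ones T}"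

section \<open>Prepending and deleting the smallest label\<close>

definition add_col :: "nat \<Rightarrow> tableau \<Rightarrow> tableau" where
  "add_col c T = T\<lparr>col_labels := insert c (col_labels T)\<rparr>"

definition add_row :: "nat \<Rightarrow> nat set \<Rightarrow> tableau \<Rightarrow> tableau" where
  "add_row r S T = T\<lparr>row_labels := insert r (row_labels T), ones := ones T \<union> {r} \<times> S\<rparr>"

text \<open>One operation undoes both kinds of prepending. Filtering \<open>ones\<close> by row
  suffices, because a column with the smallest label has no cells.\<close>

definition del_label :: "nat \<Rightarrow> tableau \<Rightarrow> tableau" where
  "del_label r T = \<lparr>row_labels = row_labels T - {r}, col_labels = col_labels T - {r},
     ones = {x \<in> ones T. fst x \<noteq> r}\<rparr>"

lemma add_row_simps [simp]:
  "row_labels (add_row r S T) = insert r (row_labels T)"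
  "col_labels (add_row r S T) = col_labels T"
  "ones (add_row r S T) = ones T \<union> {r} \<times> S"
  by (simp_all add: add_row_def)

lemma add_col_simps [simp]:
  "row_labels (add_col c T) = row_labels T"
  "col_labels (add_col c T) = insert c (col_labels T)"
  "ones (add_col c T) = ones T"
  by (simp_all add: add_col_def)

text \<open>Only the shape is assumed, not the conditions on the filling. Being a partial tableau
  can then be transferred by equivalences, which serve both directions of the later
  bijections.\<close>

locale pre_diagram =
  fixes T :: tableau and k n :: nat
  assumes labels: "row_labels T \<union> col_labels T = {Suc k<..n}"
    and disjoint: "row_labels T \<inter> col_labels T = {}"
    and ones: "ones T \<subseteq> cells T"
begin

lemma row_gt: "r \<in> row_labels T \<Longrightarrow> Suc k < r"
  and col_gt: "c \<in> col_labels T \<Longrightarrow> Suc k < c"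
  using labels by auto

lemma in_ones: "(r, c) \<in> ones T \<Longrightarrow> r \<in> row_labels T \<and> c \<in> col_labels T \<and> r < c"
  using ones by (auto simp: cells_def)

lemma in_zeros: "(r, c) \<in> zeros T \<Longrightarrow> r \<in> row_labels T \<and> c \<in> col_labels T \<and> r < c"
  by (auto simp: zeros_def cells_def)

lemma add_col_facts:
  "cells (add_col (Suc k) T) = cells T"
  "zeros (add_col (Suc k) T) = zeros T"
  "one_above (add_col (Suc k) T) = one_above T"
  "one_left (add_col (Suc k) T) = one_left T"
  "unrestricted_col (add_col (Suc k) T) = unrestricted_col T"
  "unrestricted_col T (Suc k)"
  "(r, Suc k) \<notin> ones T"
proof -
  show 1: "cells (add_col (Suc k) T) = cells T"
    using row_gt by (fastforce simp: cells_def)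
  show 2: "zeros (add_col (Suc k) T) = zeros T"
    by (simp add: zeros_def 1)
  show 3: "one_above (add_col (Suc k) T) = one_above T"
    "one_left (add_col (Suc k) T) = one_left T"
    by (simp_all add: one_above_def one_left_def fun_eq_iff)
  show "unrestricted_col (add_col (Suc k) T) = unrestricted_col T"
    by (simp add: unrestricted_col_def fun_eq_iff 2 3)
  show "unrestricted_col T (Suc k)" "(r, Suc k) \<notin> ones T"
    using col_gt in_zeros in_ones by (fastforce simp: unrestricted_col_def)+
qed

lemma add_col_partial:
  assumes "k < n"
  shows "add_col (Suc k) T \<in> partial_tableaux k n \<longleftrightarrow> T \<in> partial_tableaux (Suc k) n"
proof -
  have "{k<..n} = insert (Suc k) {Suc k<..n}" using assms by auto
  then have "row_labels T \<union> insert (Suc k) (col_labels T) = {k<..n}"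
    by (simp add: labels)
  moreover have "row_labels T \<inter> insert (Suc k) (col_labels T) = {}"
    using disjoint row_gt[of "Suc k"] by auto
  ultimately show ?thesis
    using labels disjoint ones add_col_facts(6)
    unfolding partial_tableaux_def mem_Collect_eq add_col_facts(1-5) add_col_simps by blast
qed

lemma add_col_state:
  "live_cols (add_col (Suc k) T) = live_cols T"
  "zero_cols (add_col (Suc k) T) = insert (Suc k) (zero_cols T)"
  by (auto simp: live_cols_def zero_cols_def add_col_facts)

context
  fixes S
  assumes S: "S \<subseteq> col_labels T"
begin

lemma add_row_cells:
  "cells (add_row (Suc k) S T) = cells T \<union> {Suc k} \<times> col_labels T"
proof -
  have "Suc k < c" if "c \<in> col_labels T" for c by (rule col_gt[OF that])
  then show ?thesis unfolding cells_def add_row_simps by blast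
qed

lemma add_row_zeros:
  "zeros (add_row (Suc k) S T) = zeros T \<union> {Suc k} \<times> (col_labels T - S)"
proof -
  have "r \<noteq> Suc k" if "(r, c) \<in> cells T" for r c
    using that row_gt[of r] by (auto simp: cells_def)
  then show ?thesis
    using ones S unfolding zeros_def add_row_cells by auto
qed

lemma add_row_one_left:
  "one_left (add_row (Suc k) S T) r c \<longleftrightarrow>
     (if r = Suc k then \<exists>s\<in>S. c < s else one_left T r c)"
  using row_gt in_ones by (auto simp: one_left_def)

lemma add_row_one_above:
  "one_above (add_row (Suc k) S T) r c \<longleftrightarrow> one_above T r c \<or> Suc k < r \<and> c \<in> S"
  by (auto simp: one_above_def)

lemma not_one_above: "\<not> one_above T (Suc k) c"
  using row_gt in_ones by (fastforce simp: one_above_def)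

lemma add_row_unrestricted:
  assumes "c \<in> col_labels T"
  shows "unrestricted_col (add_row (Suc k) S T) c \<longleftrightarrow>
    unrestricted_col T c \<and> (c \<in> S \<or> (\<forall>s\<in>S. s \<le> c))"
proof -
  have "r \<noteq> Suc k" if "(r, c) \<in> zeros T" for r c
    using in_zeros[OF that] row_gt by auto
  then show ?thesis
    using assms unfolding unrestricted_col_def add_row_zeros add_row_one_left
    by (auto simp: not_less)
qed

text \<open>The new row is on top, so its own 0s have nothing above them. A new 1 in column
  \<open>c\<close> lies above every old 0 of that column, hence is harmless exactly when none of
  these has a 1 to its left.\<close>

lemma add_row_cond2:
  "(\<forall>(r, c)\<in>zeros (add_row (Suc k) S T).
      \<not> (one_above (add_row (Suc k) S T) r c \<and> one_left (add_row (Suc k) S T) r c)) \<longleftrightarrow>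
   (\<forall>(r, c)\<in>zeros T. \<not> (one_above T r c \<and> one_left T r c)) \<and> (\<forall>c\<in>S. unrestricted_col T c)"
proof -
  have "Suc k < r" if "(r, c) \<in> zeros T" for r c
    using in_zeros[OF that] row_gt by auto
  then show ?thesis
    unfolding unrestricted_col_def add_row_zeros add_row_one_left add_row_one_above
    using not_one_above by fastforce
qed

lemma add_row_partial:
  assumes "k < n"
  shows "add_row (Suc k) S T \<in> partial_tableaux k n \<longleftrightarrow>
    T \<in> partial_tableaux (Suc k) n \<and> S \<in> top_rows (live_cols T) (zero_cols T)"
proof -
  have "{k<..n} = insert (Suc k) {Suc k<..n}" using assms by auto
  then have 1: "insert (Suc k) (row_labels T) \<union> col_labels T = {k<..n}"
    by (simp add: labels)
  have 2: "insert (Suc k) (row_labels T) \<inter> col_labels T = {}"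
    using disjoint col_gt[of "Suc k"] by auto
  have 3: "ones T \<union> {Suc k} \<times> S \<subseteq> cells T \<union> {Suc k} \<times> col_labels T"
    using ones S by auto
  let ?T = "add_row (Suc k) S T"
  let ?C = "\<forall>(r, c)\<in>zeros T. \<not> (one_above T r c \<and> one_left T r c)"
  let ?V = "\<lambda>T. \<forall>c\<in>col_labels T. unrestricted_col T c \<or> (\<exists>r. (r, c) \<in> ones T)"
  let ?U = "\<forall>c\<in>S. unrestricted_col T c"
  let ?Z = "\<forall>b\<in>zero_cols T. \<forall>s\<in>S. b < s \<longrightarrow> b \<in> S"
  \<comment> \<open>Columns in \<open>S\<close> satisfy the requirement on both sides. A column
    outside \<open>S\<close> becomes restricted if some new 1 lies to its left, and this matters
    only if it contains no 1.\<close>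
  have 4: "?V ?T \<longleftrightarrow> ?V T \<and> ?Z" if ?U
  proof -
    have "unrestricted_col ?T c \<or> (\<exists>r. (r, c) \<in> ones ?T) \<longleftrightarrow>
      (unrestricted_col T c \<or> (\<exists>r. (r, c) \<in> ones T)) \<and>
      (c \<in> zero_cols T \<longrightarrow> (\<forall>s\<in>S. c < s \<longrightarrow> c \<in> S))" if c: "c \<in> col_labels T" for c
    proof (cases "c \<in> S")
      case True
      then show ?thesis using \<open>?U\<close> by auto
    next
      case False
      then show ?thesis
        using c by (auto simp: add_row_unrestricted zero_cols_def not_less)
    qed
    moreover have "zero_cols T \<subseteq> col_labels T" by (auto simp: zero_cols_def)
    ultimately show ?thesis unfolding add_row_simps(2) by blast
  qed
  have 5: "S \<subseteq> live_cols T \<union> zero_cols T \<longleftrightarrow> ?U" if "?V T"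
    using that S unfolding live_cols_def zero_cols_def by blast
  have "?T \<in> partial_tableaux k n \<longleftrightarrow> ?V ?T \<and> ?C \<and> ?U"
    unfolding partial_tableaux_def mem_Collect_eq add_row_cond2
    by (simp only: add_row_cells add_row_simps 1 2 3 simp_thms)
  moreover have "T \<in> partial_tableaux (Suc k) n \<longleftrightarrow> ?V T \<and> ?C"
    by (simp only: partial_tableaux_def mem_Collect_eq labels disjoint ones simp_thms)
  moreover have "S \<in> top_rows (live_cols T) (zero_cols T) \<longleftrightarrow> S \<subseteq> live_cols T \<union> zero_cols T \<and> ?Z"
    by (simp only: top_rows_def mem_Collect_eq)
  ultimately show ?thesis using 4 5 by argo
qed

lemma add_row_state:
  assumes "T \<in> partial_tableaux (Suc k) n" "S \<in> top_rows (live_cols T) (zero_cols T)"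
  shows "live_cols (add_row (Suc k) S T) = S \<union> {a\<in>live_cols T. \<forall>s\<in>S. s < a}"
    and "zero_cols (add_row (Suc k) S T) = zero_cols T - S"
proof -
  have u: "unrestricted_col T c" if "c \<in> S" for c
  proof -
    have "c \<in> live_cols T \<union> zero_cols T" using that assms(2) by (auto simp: top_rows_def)
    moreover have "\<forall>c\<in>col_labels T. unrestricted_col T c \<or> (\<exists>r. (r, c) \<in> ones T)"
      using assms(1) by (simp add: partial_tableaux_def)
    ultimately show ?thesis by (auto simp: live_cols_def zero_cols_def)
  qed
  have b: "b \<in> S" if "b \<in> zero_cols T" "s \<in> S" "b < s" for b s
    using that assms by (auto simp: top_rows_def)
  show "zero_cols (add_row (Suc k) S T) = zero_cols T - S"
    using S by (auto simp: zero_cols_def)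
  show "live_cols (add_row (Suc k) S T) = S \<union> {a\<in>live_cols T. \<forall>s\<in>S. s < a}"
  proof -
    \<comment> \<open>For columns outside \<open>S\<close>, the conditions \<open>s \<le> c\<close>
      and \<open>s < c\<close> agree on all \<open>s\<close> in \<open>S\<close>.\<close>
    have "live_cols (add_row (Suc k) S T) = {c \<in> col_labels T.
        (unrestricted_col T c \<and> (c \<in> S \<or> (\<forall>s\<in>S. s \<le> c))) \<and> (c \<in> S \<or> (\<exists>r. (r, c) \<in> ones T))}"
      by (auto simp: live_cols_def add_row_unrestricted)
    then show ?thesis
      using S u by (auto simp: live_cols_def le_less)
  qed
qed

end

end

section \<open>Deletion inverts prepending\<close>

lemma partial_pre_diagram: "T \<in> partial_tableaux (Suc k) n \<Longrightarrow> pre_diagram T k n"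
  by (simp add: partial_tableaux_def pre_diagram_def)

lemma del_pre_diagram:
  assumes "T \<in> partial_tableaux k n"
  shows "pre_diagram (del_label (Suc k) T) k n"
proof
  have T: "row_labels T \<union> col_labels T = {k<..n}" "row_labels T \<inter> col_labels T = {}"
    "ones T \<subseteq> cells T"
    using assms by (simp_all add: partial_tableaux_def)
  have "{k<..n} - {Suc k} = {Suc k<..n}" by auto
  then show "row_labels (del_label (Suc k) T) \<union> col_labels (del_label (Suc k) T) = {Suc k<..n}"
    by (simp add: del_label_def Un_Diff[symmetric] T(1))
  show "row_labels (del_label (Suc k) T) \<inter> col_labels (del_label (Suc k) T) = {}"
    using T(2) by (auto simp: del_label_def)
  have "c \<noteq> Suc k" if "(r, c) \<in> ones T" for r c
  proof -
    have "r \<in> row_labels T" "r < c" using that T(3) by (auto simp: cells_def)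
    moreover from this have "r \<in> {k<..n}" using T(1) by blast
    ultimately show ?thesis by auto
  qed
  then show "ones (del_label (Suc k) T) \<subseteq> cells (del_label (Suc k) T)"
    using T(3) by (auto simp: del_label_def cells_def)
qed

lemma add_col_del_label:
  assumes "T \<in> partial_tableaux k n" "Suc k \<in> col_labels T"
  shows "add_col (Suc k) (del_label (Suc k) T) = T"
proof -
  have T: "Suc k \<notin> row_labels T" "ones T \<subseteq> cells T"
    using assms by (auto simp: partial_tableaux_def)
  then have "{x \<in> ones T. fst x \<noteq> Suc k} = ones T"
    by (auto simp: cells_def)
  then show ?thesis
    using T assms(2) by (intro tableau.equality) (auto simp: add_col_def del_label_def)
qed

lemma add_row_del_label:
  assumes "T \<in> partial_tableaux k n" "Suc k \<in> row_labels T"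
  shows "add_row (Suc k) {c. (Suc k, c) \<in> ones T} (del_label (Suc k) T) = T"
    and "{c. (Suc k, c) \<in> ones T} \<subseteq> col_labels (del_label (Suc k) T)"
proof -
  have T: "Suc k \<notin> col_labels T" "ones T \<subseteq> cells T"
    using assms by (auto simp: partial_tableaux_def)
  show "add_row (Suc k) {c. (Suc k, c) \<in> ones T} (del_label (Suc k) T) = T"
    using T assms(2) by (intro tableau.equality) (auto simp: add_row_def del_label_def)
  show "{c. (Suc k, c) \<in> ones T} \<subseteq> col_labels (del_label (Suc k) T)"
    using T by (auto simp: cells_def del_label_def)
qed

lemma del_label_add_col:
  assumes "pre_diagram T k n"
  shows "del_label (Suc k) (add_col (Suc k) T) = T"
proof -
  interpret pre_diagram T k n by fact
  show ?thesis
    using row_gt col_gt in_ones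
    by (intro tableau.equality) (fastforce simp: del_label_def)+
qed

lemma del_label_add_row:
  assumes "pre_diagram T k n"
  shows "del_label (Suc k) (add_row (Suc k) S T) = T"
    and "{c. (Suc k, c) \<in> ones (add_row (Suc k) S T)} = S"
proof -
  interpret pre_diagram T k n by fact
  show "del_label (Suc k) (add_row (Suc k) S T) = T"
    using row_gt col_gt in_ones
    by (intro tableau.equality) (fastforce simp: del_label_def)+
  show "{c. (Suc k, c) \<in> ones (add_row (Suc k) S T)} = S"
    using row_gt in_ones by fastforce
qed

lemma top_rows_subset: "S \<in> top_rows (live_cols T) (zero_cols T) \<Longrightarrow> S \<subseteq> col_labels T"
  by (auto simp: top_rows_def live_cols_def zero_cols_def)

lemma state_bounds:
  assumes "T \<in> partial_tableaux k n"
  shows "disj_fin (live_cols T) (zero_cols T)" "\<forall>x\<in>live_cols T \<union> zero_cols T. k < x"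
proof -
  have "col_labels T \<subseteq> {k<..n}" using assms by (auto simp: partial_tableaux_def)
  then have "live_cols T \<union> zero_cols T \<subseteq> {k<..n}"
    by (auto simp: live_cols_def zero_cols_def)
  then show "disj_fin (live_cols T) (zero_cols T)" "\<forall>x\<in>live_cols T \<union> zero_cols T. k < x"
    using finite_subset[of _ "{k<..n}"]
    by (auto simp: disj_fin_def) (auto simp: live_cols_def zero_cols_def)
qed

lemma finite_partial_tableaux: "finite (partial_tableaux k n)"
proof (rule finite_subset)
  let ?S = "Pow {k<..n} \<times> Pow {k<..n} \<times> Pow ({k<..n} \<times> {k<..n})"
  let ?f = "\<lambda>(R, C, F). \<lparr>row_labels = R, col_labels = C, ones = F\<rparr>"
  show "partial_tableaux k n \<subseteq> ?f ` ?S"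
  proof
    fix T assume T: "T \<in> partial_tableaux k n"
    then have l: "row_labels T \<subseteq> {k<..n}" "col_labels T \<subseteq> {k<..n}"
      by (auto simp: partial_tableaux_def)
    moreover have "ones T \<subseteq> {k<..n} \<times> {k<..n}"
      using T l unfolding partial_tableaux_def cells_def by blast
    ultimately have "(row_labels T, col_labels T, ones T) \<in> ?S" by blast
    moreover have "T = ?f (row_labels T, col_labels T, ones T)" by simp
    ultimately show "T \<in> ?f ` ?S" by (rule rev_image_eqI)
  qed
  show "finite (?f ` ?S)" by (intro finite_imageI finite_cartesian_product) auto
qed

section \<open>Peeling labels off the sum over tableaux\<close>

definition state_sum :: "(nat set \<Rightarrow> nat set \<Rightarrow> complex) \<Rightarrow> nat \<Rightarrow> nat \<Rightarrow> complex" where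
  "state_sum h m n = (\<Sum>T\<in>partial_tableaux m n. h (live_cols T) (zero_cols T))"

text \<open>The smallest label \<open>Suc k\<close> is either a column or a row. Deleting it gives a
  bijection onto the smaller tableaux in the first case, and onto pairs of a smaller tableau and an
  admissible row \<open>S\<close> in the second.\<close>

lemma state_sum_step:
  assumes "k < n"
  shows "state_sum h k n = (\<Sum>T\<in>partial_tableaux (Suc k) n.
    h (live_cols T) (insert (Suc k) (zero_cols T)) + row_sum h (live_cols T) (zero_cols T))"
proof -
  let ?P = "partial_tableaux k n" and ?Q = "partial_tableaux (Suc k) n"
  let ?C = "{T \<in> ?P. Suc k \<in> col_labels T}" and ?R = "{T \<in> ?P. Suc k \<in> row_labels T}"
  let ?h = "\<lambda>T. h (live_cols T) (zero_cols T)"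
  let ?D = "\<lambda>T. top_rows (live_cols T) (zero_cols T)"
  have "Suc k \<in> row_labels T \<union> col_labels T" "row_labels T \<inter> col_labels T = {}"
    if "T \<in> ?P" for T
    using that assms by (auto simp: partial_tableaux_def)
  then have "?P = ?C \<union> ?R" "?C \<inter> ?R = {}" by blast+
  then have "sum ?h ?P = sum ?h ?C + sum ?h ?R"
    using finite_partial_tableaux[of k n] by (metis (no_types, lifting) finite_Un sum.union_disjoint)
  moreover have "sum ?h ?C = (\<Sum>T\<in>?Q. h (live_cols T) (insert (Suc k) (zero_cols T)))"
  proof (rule sum.reindex_bij_witness[of _ "add_col (Suc k)" "del_label (Suc k)"], goal_cases)
    case (1 T)
    then show ?case using add_col_del_label by blast
  next
    case (2 T)
    then have "add_col (Suc k) (del_label (Suc k) T) \<in> ?P"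
      using add_col_del_label[of T k n] by simp
    then show ?case
      using 2 pre_diagram.add_col_partial[OF del_pre_diagram] assms by blast
  next
    case (3 T)
    then show ?case using del_label_add_col partial_pre_diagram by blast
  next
    case (4 T)
    then show ?case
      using pre_diagram.add_col_partial[OF partial_pre_diagram] assms by simp
  next
    case (5 T)
    then have "pre_diagram (del_label (Suc k) T) k n" "add_col (Suc k) (del_label (Suc k) T) = T"
      using del_pre_diagram add_col_del_label by blast+
    then show ?case
      using pre_diagram.add_col_state by metis
  qed
  moreover have "sum ?h ?R = (\<Sum>(T, S)\<in>Sigma ?Q ?D.
      h (S \<union> {a\<in>live_cols T. \<forall>s\<in>S. s < a}) (zero_cols T - S))"
  proof (rule sum.reindex_bij_witness[of _ "\<lambda>(T, S). add_row (Suc k) S T"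
        "\<lambda>T. (del_label (Suc k) T, {c. (Suc k, c) \<in> ones T})"], goal_cases)
    case (1 T)
    then show ?case using add_row_del_label(1)[of T k n] by simp
  next
    case (2 T)
    then have "add_row (Suc k) {c. (Suc k, c) \<in> ones T} (del_label (Suc k) T) \<in> ?P"
      using add_row_del_label(1)[of T k n] by simp
    then show ?case
      using 2 pre_diagram.add_row_partial[OF del_pre_diagram add_row_del_label(2)] assms by blast
  next
    case (3 x)
    obtain T S where x: "x = (T, S)" by (cases x)
    then have "pre_diagram T k n" using 3 partial_pre_diagram by blast
    then show ?case by (simp only: x prod.case del_label_add_row)
  next
    case (4 x)
    obtain T S where x: "x = (T, S)" by (cases x)
    then have T: "T \<in> ?Q" "S \<in> ?D T" using 4 by auto
    then have "add_row (Suc k) S T \<in> ?P"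
      using pre_diagram.add_row_partial[OF partial_pre_diagram top_rows_subset] assms by blast
    then show ?case by (simp add: x)
  next
    case (5 T)
    let ?T = "del_label (Suc k) T" and ?S = "{c. (Suc k, c) \<in> ones T}"
    have T: "pre_diagram ?T k n" "?S \<subseteq> col_labels ?T" "add_row (Suc k) ?S ?T = T"
      using 5 del_pre_diagram add_row_del_label by blast+
    then have "?T \<in> ?Q" "?S \<in> ?D ?T"
      using pre_diagram.add_row_partial[OF T(1,2)] 5 assms by auto
    from pre_diagram.add_row_state[OF T(1,2) this] T(3)
    show ?case by simp
  qed
  ultimately show ?thesis
    unfolding state_sum_def row_sum_def sum.distrib
    using finite_partial_tableaux finite_top_rows state_bounds(1)
    by (subst (asm) sum.Sigma[symmetric]) auto
qed

text \<open>A prepended column contributes - q V e, a prepended row p V e + q (3 V e - 2 e).\<close>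

lemma state_sum_sgn_step:
  assumes "k < n"
  shows "state_sum (\<lambda>A B. p * sgn_state A B + q * row_sgn A B) k n =
    state_sum (\<lambda>A B. (- 2 * q) * sgn_state A B + (p + 2 * q) * row_sgn A B) (Suc k) n"
  unfolding state_sum_step[OF assms]
  unfolding state_sum_def row_sum_linear
  using state_bounds
  by (intro sum.cong refl)
    (simp add: row_sgn_insert_below row_sum_row_sgn, simp add: algebra_simps)

text \<open>In the basis e, V e - e the coefficients are x = p + q and y = q, and a step sends x + y
  \<i> to (1 + \<i>) (x + y \<i>). Starting from x = 1, y = 0, they are the real and imaginary parts
  of (1 + \<i>)^m. The coefficient of e is p = x - y, the value of x one step later, whence the
  extra factors.\<close>

lemma state_sum_sgn:
  assumes "m \<le> n"
  shows "state_sum sgn_state 0 n = state_sum (\<lambda>A B.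
     ((1 + \<i>) ^ m * (1 + \<i>) + (1 - \<i>) ^ m * (1 - \<i>)) / 2 * sgn_state A B
     + ((1 + \<i>) ^ m - (1 - \<i>) ^ m) / (2 * \<i>) * row_sgn A B) m n"
  using assms
proof (induction m)
  case 0
  then show ?case by simp
next
  case (Suc m)
  show ?case
    unfolding Suc.IH[OF Suc_leD[OF Suc.prems]] state_sum_sgn_step[OF Suc_le_lessD[OF Suc.prems]]
    by (intro arg_cong[of _ _ "\<lambda>h. state_sum h (Suc m) n"] ext
        arg_cong2[of _ _ _ _ "\<lambda>p q. p * _ + q * _"]) (simp_all add: field_simps)
qed

lemma state_sum_start: "state_sum h n n = h {} {}"
proof -
  let ?T = "\<lparr>row_labels = {}, col_labels = {}, ones = {}\<rparr>"
  have "partial_tableaux n n = {?T}"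
    by (auto simp: partial_tableaux_def cells_def zeros_def intro!: tableau.equality)
  then show ?thesis
    by (simp add: state_sum_def live_cols_def zero_cols_def)
qed

text \<open>A partial tableau on all labels is a permutation tableau exactly when no column lacks a
  1. The others have weight 0, and for permutation tableaux the live columns are all the
  unrestricted ones.\<close>

lemma sum_sign_eq_state_sum:
  "(\<Sum>T\<in>perm_tableaux n. complex_of_int (tableau_sign T)) = state_sum sgn_state 0 n"
proof -
  have n: "{1..n} = {0<..n}" by auto
  have P: "perm_tableaux n = {T \<in> partial_tableaux 0 n. zero_cols T = {}}"
    unfolding perm_tableaux_def partial_tableaux_def filled_diagram_def n zero_cols_def by blast
  have "live_cols T = {c \<in> col_labels T. unrestricted_col T c}" if "zero_cols T = {}" for T
    using that by (auto simp: live_cols_def zero_cols_def)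
  then show ?thesis
    unfolding state_sum_def P
    by (intro sum.mono_neutral_cong_left finite_partial_tableaux)
      (auto simp: sgn_state_def tableau_sign_def urc_def)
qed

theorem corollary1p3:
  fixes n :: nat
  shows "(\<Sum>T \<in> perm_tableaux n. complex_of_int (tableau_sign T))
           = ((1 + \<i>) ^ n + (1 - \<i>) ^ n) / 2"
  \<comment> \<open>After all \<open>n\<close> labels are removed, e and V e are both 1 at the empty
    state, so the sum is p + q = x, the real part of (1 + \<i>)^n.\<close>
  unfolding sum_sign_eq_state_sum state_sum_sgn[OF order_refl] state_sum_start
  by (simp add: sgn_state_def field_simps)

end
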